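(* Let $N\ge 2$ and let $\mathbf X\in\mathbb R^{I_1\times I_2\times\cdots\times I_N\times T}$ be a real tensor, viewed as an $N$-way hyper-tensor of size $I_1\times\cdots\times I_N$ with tube length $T$. Let $(r_1,\dots,r_{N-1})$ be a prescribed tubal rank profile, and run the algorithm TTT-SVD (fixed-rank version, described in the context) on $\mathbf X$ with this rank profile. For $n=1,\dots,N-1$, let $\mathbf C_n$ denote the current (reshaped) hyper-matrix to which the truncated T-SVD is applied at step $n$, and let $\mathbf U_n,\mathbf S_n,\mathbf V_n$ be the factors of its rank-$r_n$ truncated T-SVD computed at that step. Suppose that the local errors are bounded by $$\bigl\|\mathbf C_n-\mathbf U_n*\mathbf S_n*\mathbf V_n^{T}\bigr\|_F\le \delta_n,\qquad n=1,\dots,N-1.$$ Then the final TTT approximation $\mathbf Y=\ll \mathbf Y^{(1)},\dots,\mathbf Y^{(N)}\gg$ returned by the algorithm satisfies $$\|\mathbf X-\mathbf Y\|_F^2\le\sum_{n=1}^{N-1}\delta_n^2 .$$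
   Context: **Norm and tubes.** $\|\cdot\|_F$ is the Frobenius norm (square root of the sum of squared entries). The last mode of every tensor, of length $T$, is the tube mode. A tensor in $\mathbb R^{I_1\times\cdots\times I_N\times T}$ is viewed as an $N$-way array (hyper-tensor) whose entries are tubes in $\mathbb R^T$; a third-order tensor in $\mathbb R^{I\times J\times T}$ is viewed as an $I\times J$ hyper-matrix of tubes. The circular convolution of $\mathbf x,\mathbf y\in\mathbb R^T$ is $(\mathbf x\circledast\mathbf y)_t=\sum_{s\in\mathbb Z/T}\mathbf x_s\,\mathbf y_{t-s}$, with indices taken modulo $T$ (the first entry of a tube having index $0$). **t-product.** For $\mathbf A\in\mathbb R^{I\times J\times T}$ and $\mathbf B\in\mathbb R^{J\times K\times T}$, the t-product $\mathbf A*\mathbf B\in\mathbb R^{I\times K\times T}$ has tubes $(\mathbf A*\mathbf B)(i,k,:)=\sum_{j=1}^J\mathbf A(i,j,:)\circledast\mathbf B(j,k,:)$. Let $\widehat{\mathbf A}$ denote the (unnormalized) discrete Fourier transform of $\mathbf A$ along the tube mode. Then $\widehat{\mathbf A*\mathbf B}(:,:,t)=\widehat{\mathbf A}(:,:,t)\,\widehat{\mathbf B}(:,:,t)$ for all $t$. The transpose $\mathbf A^T\in\mathbb R^{J\times I\times T}$ is obtained by transposing each frontal slice $\mathbf A(:,:,t)$ and reversing the order of slices $2,\dots,T$; equivalently, each Fourier slice is replaced by its conjugate transpose. **Truncated T-SVD of tubal rank $R$.** For $\mathbf C\in\mathbb R^{I\times J\times T}$ and $1\le R\le\min(I,J)$,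 a rank-$R$ truncated T-SVD of $\mathbf C$ consists of real tensors $\mathbf U\in\mathbb R^{I\times R\times T}$, $\mathbf S\in\mathbb R^{R\times R\times T}$, $\mathbf V\in\mathbb R^{J\times R\times T}$ such that, for every $t$, $\widehat{\mathbf U}(:,:,t)\,\widehat{\mathbf S}(:,:,t)\,\widehat{\mathbf V}(:,:,t)^{H}$ is a rank-$R$ truncated singular value decomposition of the matrix $\widehat{\mathbf C}(:,:,t)$: $\widehat{\mathbf S}(:,:,t)$ is diagonal and contains the $R$ largest singular values, and $\widehat{\mathbf U}(:,:,t)$, $\widehat{\mathbf V}(:,:,t)$ have orthonormal columns that are corresponding left and right singular vectors. (The SVDs of conjugate pairs of Fourier slices are chosen complex conjugate to each other, and the SVDs of real Fourier slices are chosen real, so that $\mathbf U,\mathbf S,\mathbf V$ are real.) **TTT contraction.** Given cores $\mathbf Y^{(1)}\in\mathbb R^{I_1\times r_1\times T}$, $\mathbf Y^{(n)}\in\mathbb R^{r_{n-1}\times I_n\times r_n\times T}$ for $2\le n\le N-1$, and $\mathbf Y^{(N)}\in\mathbb R^{r_{N-1}\times I_N\times T}$, the tensor $\mathbf Y=\ll\mathbf Y^{(1)},\dots,\mathbf Y^{(N)}\gg\in\mathbb R^{I_1\times\cdots\times I_N\times T}$ is defined tube-wise by $$\mathbf Y(i_1,\dots,i_N,:)=\sum_{a_1=1}^{r_1}\cdots\sum_{a_{N-1}=1}^{r_{N-1}}\mathbf Y^{(1)}(i_1,a_1,:)\circledast\mathbf Y^{(2)}(a_1,i_2,a_2,:)\circledast\cdots\circledast\mathbf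 Y^{(N)}(a_{N-1},i_N,:).$$ **Algorithm TTT-SVD (fixed-rank version).** Input: $\mathbf X\in\mathbb R^{I_1\times\cdots\times I_N\times T}$ and $(r_1,\dots,r_{N-1})$. All reshapes only group or split the non-tube indices, using one fixed consistent ordering of multi-indices, and leave the tube mode unchanged. 1. Let $\mathbf C_1\in\mathbb R^{I_1\times(I_2\cdots I_N)\times T}$ be the reshaping of $\mathbf X$. Compute a rank-$r_1$ truncated T-SVD $(\mathbf U_1,\mathbf S_1,\mathbf V_1)$ of $\mathbf C_1$. Set $\mathbf Y^{(1)}=\mathbf U_1$ and $\mathbf C=\mathbf S_1*\mathbf V_1^T\in\mathbb R^{r_1\times(I_2\cdots I_N)\times T}$. 2. For $n=2,\dots,N-1$: let $\mathbf C_n\in\mathbb R^{(r_{n-1}I_n)\times(I_{n+1}\cdots I_N)\times T}$ be the reshaping of $\mathbf C$. Compute a rank-$r_n$ truncated T-SVD $(\mathbf U_n,\mathbf S_n,\mathbf V_n)$ of $\mathbf C_n$. Let $\mathbf Y^{(n)}\in\mathbb R^{r_{n-1}\times I_n\times r_n\times T}$ be the reshaping of $\mathbf U_n$, and set $\mathbf C=\mathbf S_n*\mathbf V_n^T$. 3. Set $\mathbf Y^{(N)}=\mathbf C\in\mathbb R^{r_{N-1}\times I_N\times T}$. Output: the cores $\mathbf Y^{(1)},\dots,\mathbf Y^{(N)}$, and the approximation $\mathbf Y=\ll\mathbf Y^{(1)},\dots,\mathbf Y^{(N)}\gg$. The ranks are assumed admissible for the truncated T-SVDs, i.e. $1\le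 r_1\le\min(I_1,I_2\cdots I_N)$ and $1\le r_n\le\min(r_{n-1}I_n,I_{n+1}\cdots I_N)$ for $2\le n\le N-1$. *)

theory Defs
  imports Jordan_Normal_Form.Schur_Decomposition
    "HOL-Computational_Algebra.Fundamental_Theorem_Algebra"
begin

section \<open>Tubes, hyper-matrices and hyper-tensors\<close>

text \<open>
  Sizes are carried separately from the entries: a tube of length \<open>T\<close> is read at indices
  \<open>t < T\<close>, a hyper-matrix of size \<open>I \<times> J\<close> at \<open>i < I\<close>, \<open>j < J\<close>, and a hyper-tensor of shape \<open>ds\<close>
  at the multi-indices of \<open>ds\<close>. All index values start at 0; values outside the
  ranges are irrelevant.
\<close>

type_synonym tube = "nat \<Rightarrow> real"
type_synonym hmatrix = "nat \<Rightarrow> nat \<Rightarrow> tube"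
type_synonym hcore = "nat \<Rightarrow> nat \<Rightarrow> nat \<Rightarrow> tube"
type_synonym htensor = "nat list \<Rightarrow> tube"

definition multi_indices :: "nat list \<Rightarrow> nat list set" where
  "multi_indices ds = {is. list_all2 (<) is ds}"

definition frob_hmatrix :: "nat \<Rightarrow> nat \<Rightarrow> nat \<Rightarrow> hmatrix \<Rightarrow> real" where
  "frob_hmatrix I J T A = sqrt (\<Sum>i<I. \<Sum>j<J. \<Sum>t<T. (A i j t)\<^sup>2)"

definition frob_htensor :: "nat list \<Rightarrow> nat \<Rightarrow> htensor \<Rightarrow> real" where
  "frob_htensor ds T X = sqrt (\<Sum>is\<in>multi_indices ds. \<Sum>t<T. (X is t)\<^sup>2)"

text \<open>For \<open>s < T\<close> the index \<open>(t + T - s) mod T\<close> is \<open>t - s\<close> modulo \<open>T\<close>.\<close>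

definition circ_conv :: "nat \<Rightarrow> tube \<Rightarrow> tube \<Rightarrow> tube" where
  "circ_conv T x y t = (\<Sum>s<T. x s * y ((t + T - s) mod T))"

text \<open>In \<open>t_prod J T A B\<close>, \<open>J\<close> is the number of columns of \<open>A\<close> and of rows of \<open>B\<close>.\<close>

definition t_prod :: "nat \<Rightarrow> nat \<Rightarrow> hmatrix \<Rightarrow> hmatrix \<Rightarrow> hmatrix" where
  "t_prod J T A B i k t = (\<Sum>j<J. circ_conv T (A i j) (B j k) t)"

definition t_transpose :: "nat \<Rightarrow> hmatrix \<Rightarrow> hmatrix" where
  "t_transpose T A j i t = A i j ((T - t) mod T)"

definition fourier_slice :: "nat \<Rightarrow> nat \<Rightarrow> nat \<Rightarrow> hmatrix \<Rightarrow> nat \<Rightarrow> complex mat" where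
  "fourier_slice I J T A t =
     mat I J (\<lambda>(i, j). \<Sum>s<T. complex_of_real (A i j s) * cis (- 2 * pi * real s * real t / real T))"


section \<open>Truncated SVD and T-SVD\<close>

definition singular_values :: "complex mat \<Rightarrow> real list" where
  "singular_values M = take (min (dim_row M) (dim_col M))
     (rev (sorted_list_of_multiset
       (image_mset (\<lambda>z. sqrt (Re z)) (proots (char_poly (mat_adjoint M * M))))))"

text \<open>
  The comparison of multisets leaves the order of the \<open>R\<close> largest singular
  values on the diagonal of \<open>S\<close> free; the decreasing order is a special case.
\<close>

definition truncated_svd ::
  "nat \<Rightarrow> complex mat \<Rightarrow> complex mat \<Rightarrow> complex mat \<Rightarrow> complex mat \<Rightarrow> bool" where
  "truncated_svd R M U S V \<longleftrightarrow>
     U \<in> carrier_mat (dim_row M) R \<and> S \<in> carrier_mat R R \<and> V \<in> carrier_mat (dim_col M) R \<and>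
     diagonal_mat S \<and>
     mset (diag_mat S) = image_mset complex_of_real (mset (take R (singular_values M))) \<and>
     mat_adjoint U * U = 1\<^sub>m R \<and> mat_adjoint V * V = 1\<^sub>m R \<and>
     (\<forall>k<R. M *\<^sub>v col V k = S $$ (k, k) \<cdot>\<^sub>v col U k \<and>
            mat_adjoint M *\<^sub>v col U k = S $$ (k, k) \<cdot>\<^sub>v col V k)"

text \<open>
  Since \<open>U\<close>, \<open>S\<close>, \<open>V\<close> are real, their Fourier slices at \<open>t\<close> and \<open>- t\<close> modulo \<open>T\<close> are
  automatically complex conjugate to each other.
\<close>

definition truncated_tsvd ::
  "nat \<Rightarrow> nat \<Rightarrow> nat \<Rightarrow> nat \<Rightarrow> hmatrix \<Rightarrow> hmatrix \<Rightarrow> hmatrix \<Rightarrow> hmatrix \<Rightarrow> bool" where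
  "truncated_tsvd I J T R C U S V \<longleftrightarrow>
     (\<forall>t<T. truncated_svd R (fourier_slice I J T C t)
        (fourier_slice I R T U t) (fourier_slice R R T S t) (fourier_slice J R T V t))"


section \<open>Orderings of multi-indices\<close>

text \<open>
  An ordering assigns to a multi-index of shape \<open>ds\<close> its position among all multi-indices of that
  shape. A single index is its own position, so that a mode that is not grouped with others
  is left unchanged.
\<close>

definition index_ordering :: "(nat list \<Rightarrow> nat list \<Rightarrow> nat) \<Rightarrow> bool" where
  "index_ordering enc \<longleftrightarrow>
     (\<forall>ds. bij_betw (enc ds) (multi_indices ds) {..<prod_list ds}) \<and>
     (\<forall>d i. i < d \<longrightarrow> enc [d] [i] = i)"

definition decode :: "(nat list \<Rightarrow> nat list \<Rightarrow> nat) \<Rightarrow> nat list \<Rightarrow> nat \<Rightarrow> nat list" where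
  "decode enc ds = inv_into (multi_indices ds) (enc ds)"

text \<open>Row-major and column-major order are instances.\<close>

fun row_major :: "nat list \<Rightarrow> nat list \<Rightarrow> nat" where
  "row_major (d # ds) (i # is) = i * prod_list ds + row_major ds is"
| "row_major _ _ = 0"

fun col_major :: "nat list \<Rightarrow> nat list \<Rightarrow> nat" where
  "col_major (d # ds) (i # is) = i + d * col_major ds is"
| "col_major _ _ = 0"

lemma multi_indices_Nil: "multi_indices [] = {[]}"
  by (auto simp: multi_indices_def)

lemma multi_indices_Cons:
  "multi_indices (d # ds) = (\<lambda>(i, is). i # is) ` ({..<d} \<times> multi_indices ds)"
  by (auto simp: multi_indices_def list_all2_Cons2 image_iff)

lemma card_multi_indices: "finite (multi_indices ds) \<and> card (multi_indices ds) = prod_list ds"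
proof (induction ds)
  case Nil
  show ?case by (simp add: multi_indices_Nil)
next
  case (Cons d ds)
  have "inj_on (\<lambda>(i, is). i # is) ({..<d} \<times> multi_indices ds)"
    by (auto simp: inj_on_def)
  then show ?case
    using Cons by (simp add: multi_indices_Cons card_image card_cartesian_product)
qed

lemma bij_betw_multi_indicesI:
  assumes "f ` multi_indices ds \<subseteq> {..<prod_list ds}" and "inj_on f (multi_indices ds)"
  shows "bij_betw f (multi_indices ds) {..<prod_list ds}"
proof -
  have "f ` multi_indices ds = {..<prod_list ds}"
    using assms card_multi_indices[of ds] by (intro card_subset_eq) (auto simp: card_image)
  then show ?thesis using assms(2) by (simp add: bij_betw_def)
qed

lemma mixed_radix_less: "i < d \<Longrightarrow> k < p \<Longrightarrow> i * p + k < d * (p::nat)"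
proof -
  assume "i < d" "k < p"
  then have "i * p + k < Suc i * p" by simp
  also have "\<dots> \<le> d * p" using \<open>i < d\<close> by (intro mult_le_mono1) simp
  finally show ?thesis .
qed

lemma mixed_radix_inj:
  assumes "k < p" "k' < p" "i * p + k = i' * p + (k'::nat)"
  shows "i = i' \<and> k = k'"
proof -
  have "(i * p + k) div p = i" "(i' * p + k') div p = i'" using assms(1,2) by simp_all
  then show ?thesis using assms(3) by simp
qed

lemma index_ordering_row_major: "index_ordering row_major"
proof -
  have less: "is \<in> multi_indices ds \<Longrightarrow> row_major ds is < prod_list ds" for ds "is"
    by (induction ds arbitrary: "is")
       (auto simp: multi_indices_Nil multi_indices_Cons intro!: mixed_radix_less)
  have "inj_on (row_major ds) (multi_indices ds)" for ds
  proof (induction ds)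
    case Nil
    show ?case by (simp add: multi_indices_Nil)
  next
    case (Cons d ds)
    show ?case
    proof (rule inj_onI)
      fix x y
      assume "x \<in> multi_indices (d # ds)" "y \<in> multi_indices (d # ds)"
        and eq: "row_major (d # ds) x = row_major (d # ds) y"
      then obtain i j "is" js where xy: "x = i # is" "y = j # js"
        "is \<in> multi_indices ds" "js \<in> multi_indices ds"
        by (auto simp: multi_indices_Cons)
      then have "i = j \<and> row_major ds is = row_major ds js"
        using eq less by (intro mixed_radix_inj[of _ "prod_list ds"]) auto
      with xy Cons show "x = y" by (auto dest: inj_onD)
    qed
  qed
  with less show ?thesis
    by (auto simp: index_ordering_def intro!: bij_betw_multi_indicesI)
qed

lemma index_ordering_col_major: "index_ordering col_major"
proof -
  have less: "is \<in> multi_indices ds \<Longrightarrow> col_major ds is < prod_list ds" for ds "is"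
  proof (induction ds arbitrary: "is")
    case Nil
    then show ?case by (simp add: multi_indices_Nil)
  next
    case (Cons d ds)
    then obtain i js where "is = i # js" "i < d" "js \<in> multi_indices ds"
      by (auto simp: multi_indices_Cons)
    moreover from this have "col_major ds js * d + i < prod_list ds * d"
      using Cons.IH by (intro mixed_radix_less) auto
    ultimately show ?case by (simp add: mult.commute add.commute)
  qed
  have "inj_on (col_major ds) (multi_indices ds)" for ds
  proof (induction ds)
    case Nil
    show ?case by (simp add: multi_indices_Nil)
  next
    case (Cons d ds)
    show ?case
    proof (rule inj_onI)
      fix x y
      assume "x \<in> multi_indices (d # ds)" "y \<in> multi_indices (d # ds)"
        and eq: "col_major (d # ds) x = col_major (d # ds) y"
      then obtain i j "is" js where xy: "x = i # is" "y = j # js" "i < d" "j < d"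
        "is \<in> multi_indices ds" "js \<in> multi_indices ds"
        by (auto simp: multi_indices_Cons)
      then have "col_major ds is = col_major ds js \<and> i = j"
        using eq by (intro mixed_radix_inj[of _ d]) (auto simp: mult.commute add.commute)
      with xy Cons show "x = y" by (auto dest: inj_onD)
    qed
  qed
  with less show ?thesis
    by (auto simp: index_ordering_def intro!: bij_betw_multi_indicesI)
qed


section \<open>TTT contraction and the TTT-SVD algorithm\<close>

text \<open>
  The modes of a hyper-tensor are numbered from 1 to \<open>N\<close>, with sizes \<open>I 1, \<dots>, I N\<close> and ranks
  \<open>r 1, \<dots>, r (N - 1)\<close>. Lists are indexed from 0, so the index of mode \<open>n\<close> is \<open>is ! (n - 1)\<close>
  and the summation index running up to \<open>r n\<close> is \<open>a ! (n - 1)\<close>. The first and last cores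
  have only one rank mode.
\<close>

definition ttt_contraction ::
  "nat \<Rightarrow> (nat \<Rightarrow> nat) \<Rightarrow> nat \<Rightarrow> hmatrix \<Rightarrow> (nat \<Rightarrow> hcore) \<Rightarrow> hmatrix \<Rightarrow> htensor" where
  "ttt_contraction N r T Yfirst Ymid Ylast is t =
     (\<Sum>a\<in>multi_indices (map r [1..<N]).
        foldl (circ_conv T) (Yfirst (is ! 0) (a ! 0))
          (map (\<lambda>n. Ymid n (a ! (n - 2)) (is ! (n - 1)) (a ! (n - 1))) [2..<N]
             @ [Ylast (a ! (N - 2)) (is ! (N - 1))]) t)"

definition step_rows :: "(nat \<Rightarrow> nat) \<Rightarrow> (nat \<Rightarrow> nat) \<Rightarrow> nat \<Rightarrow> nat" where
  "step_rows I r n = (if n = 1 then I 1 else r (n - 1) * I n)"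

definition step_cols :: "nat \<Rightarrow> (nat \<Rightarrow> nat) \<Rightarrow> nat \<Rightarrow> nat" where
  "step_cols N I n = (\<Prod>k\<in>{n+1..N}. I k)"

definition unfold_first ::
  "(nat list \<Rightarrow> nat list \<Rightarrow> nat) \<Rightarrow> nat \<Rightarrow> (nat \<Rightarrow> nat) \<Rightarrow> htensor \<Rightarrow> hmatrix" where
  "unfold_first enc N I X i j = X (i # decode enc (map I [2..<N+1]) j)"

text \<open>
  Reshaping \<open>C\<close> of size \<open>r (n - 1) \<times> (I n \<cdots> I N)\<close> to size
  \<open>(r (n - 1) I n) \<times> (I (n + 1) \<cdots> I N)\<close>: the row \<open>p\<close> stands for a pair \<open>(a, i)\<close>, the column \<open>q\<close>
  for the indices \<open>js\<close> of the modes \<open>n + 1, \<dots>, N\<close>, and the entry is that of \<open>C\<close> at row \<open>a\<close>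
  and the column standing for \<open>(i, js)\<close>.
\<close>

definition regroup ::
  "(nat list \<Rightarrow> nat list \<Rightarrow> nat) \<Rightarrow> nat \<Rightarrow> (nat \<Rightarrow> nat) \<Rightarrow> (nat \<Rightarrow> nat) \<Rightarrow> nat \<Rightarrow> hmatrix \<Rightarrow> hmatrix"
where
  "regroup enc N I r n C p q =
     (let ai = decode enc [r (n - 1), I n] p;
          js = decode enc (map I [n+1..<N+1]) q
      in C (ai ! 0) (enc (map I [n..<N+1]) (ai ! 1 # js)))"

definition split_rows ::
  "(nat list \<Rightarrow> nat list \<Rightarrow> nat) \<Rightarrow> nat \<Rightarrow> nat \<Rightarrow> hmatrix \<Rightarrow> hcore" where
  "split_rows enc r' d U a i b = U (enc [r', d] [a, i]) b"

text \<open>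
  A run is a relation because truncated T-SVDs are not unique: \<open>C n\<close> is the
  hyper-matrix decomposed at step \<open>n\<close>, with computed factors \<open>U n\<close>, \<open>S n\<close>, \<open>V n\<close>.
\<close>

definition ttt_svd_run ::
  "(nat list \<Rightarrow> nat list \<Rightarrow> nat) \<Rightarrow> nat \<Rightarrow> (nat \<Rightarrow> nat) \<Rightarrow> (nat \<Rightarrow> nat) \<Rightarrow> nat \<Rightarrow> htensor \<Rightarrow>
   (nat \<Rightarrow> hmatrix) \<Rightarrow> (nat \<Rightarrow> hmatrix) \<Rightarrow> (nat \<Rightarrow> hmatrix) \<Rightarrow> (nat \<Rightarrow> hmatrix) \<Rightarrow>
   hmatrix \<Rightarrow> (nat \<Rightarrow> hcore) \<Rightarrow> hmatrix \<Rightarrow> bool" where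
  "ttt_svd_run enc N I r T X C U S V Yfirst Ymid Ylast \<longleftrightarrow>
     C 1 = unfold_first enc N I X \<and>
     (\<forall>n\<in>{1..<N}. truncated_tsvd (step_rows I r n) (step_cols N I n) T (r n) (C n) (U n) (S n) (V n)) \<and>
     (\<forall>n\<in>{2..<N}. C n =
        regroup enc N I r n (t_prod (r (n - 1)) T (S (n - 1)) (t_transpose T (V (n - 1))))) \<and>
     Yfirst = U 1 \<and>
     (\<forall>n\<in>{2..<N}. Ymid n = split_rows enc (r (n - 1)) (I n) (U n)) \<and>
     Ylast = t_prod (r (N - 1)) T (S (N - 1)) (t_transpose T (V (N - 1)))"

end

theory Submission
  imports Defs
begin

text \<open>
  On Fourier slices, the singular vector equations say that \<open>U\<close> is orthonormal for the t-product
  and \<open>U\<^sup>T * C = S * V\<^sup>T\<close>; injectivity of the Fourier transform carries both identities over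
  to the real tensors. Hence \<open>U * S * V\<^sup>T\<close> is the orthogonal projection of \<open>C\<close> onto the range
  of \<open>U\<close>, multiplication by \<open>U\<close> is an isometry, and for every \<open>D\<close>
  \<open>\<parallel>C - U * D\<parallel>\<^sup>2 = \<parallel>C - U * S * V\<^sup>T\<parallel>\<^sup>2 + \<parallel>S * V\<^sup>T - D\<parallel>\<^sup>2\<close>.
  Taking for \<open>D\<close> the contraction of the cores after step \<open>n\<close> and going from the last step down to
  the first, the squared total error is exactly the sum of the squared local errors.
\<close>

section \<open>Circular convolution and the t-product\<close>

text \<open>Since \<open>u \<le> T\<close>, the natural-number subtraction never truncates, so
  cyclic index identities can be checked in the integers modulo \<open>T\<close>.\<close>

lemma int_cyclic_diff:
  assumes "u \<le> T"
  shows "int ((t + T - u) mod T) = (int t - int u) mod int T"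
proof -
  have "int ((t + T - u) mod T) = (int t - int u + int T) mod int T"
    using assms by (simp add: zmod_int of_nat_diff algebra_simps)
  then show ?thesis by simp
qed

text \<open>Translation by \<open>u\<close> permutes Z/T. The two arguments of \<open>f\<close> let
  a summand depend on an index and on its translate at once.\<close>

lemma sum_cyclic_shift:
  fixes f :: "nat \<Rightarrow> nat \<Rightarrow> 'a::comm_monoid_add"
  assumes "u < T"
  shows "(\<Sum>s<T. f s ((s + T - u) mod T)) = (\<Sum>s<T. f ((s + u) mod T) s)"
proof (rule sum.reindex_bij_witness[of _ "\<lambda>s. (s + u) mod T" "\<lambda>s. (s + T - u) mod T"])
  fix s assume "s \<in> {..<T}"
  then have s: "s < T" by simp
  have 1: "int (((s + T - u) mod T + u) mod T) = int s"
    using assms s by (simp add: zmod_int int_cyclic_diff mod_simps)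
  show "((s + T - u) mod T + u) mod T = s" using 1 by linarith
  then show "f (((s + T - u) mod T + u) mod T) ((s + T - u) mod T) = f s ((s + T - u) mod T)" by simp
  show "(s + T - u) mod T \<in> {..<T}" "(s + u) mod T \<in> {..<T}" using s by auto
  have "int (((s + u) mod T + T - u) mod T) = int s"
    using assms s by (subst int_cyclic_diff) (auto simp: zmod_int mod_simps)
  then show "((s + u) mod T + T - u) mod T = s" by linarith
qed

lemma sum_cyclic_reverse:
  fixes f :: "nat \<Rightarrow> nat \<Rightarrow> 'a::comm_monoid_add"
  shows "(\<Sum>s<T. f s ((T - s) mod T)) = (\<Sum>s<T. f ((T - s) mod T) s)"
proof (rule sum.reindex_bij_witness[of _ "\<lambda>s. (T - s) mod T" "\<lambda>s. (T - s) mod T"])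
  fix s assume "s \<in> {..<T}"
  then have s: "s < T" by simp
  show eq: "(T - (T - s) mod T) mod T = s" using s by (cases "s = 0") auto
  then show "(T - (T - s) mod T) mod T = s" .
  show "f ((T - (T - s) mod T) mod T) ((T - s) mod T) = f s ((T - s) mod T)" using eq by simp
  show "(T - s) mod T \<in> {..<T}" "(T - s) mod T \<in> {..<T}" using s by auto
qed

lemma circ_conv_cong:
  assumes "\<And>s. s < T \<Longrightarrow> x s = x' s" "\<And>s. s < T \<Longrightarrow> y s = y' s"
  shows "circ_conv T x y t = circ_conv T x' y' t"
  using assms by (auto simp: circ_conv_def intro!: sum.cong)

lemma circ_conv_sum_left:
  "circ_conv T (\<lambda>s. \<Sum>b\<in>B. x b s) y t = (\<Sum>b\<in>B. circ_conv T (x b) y t)"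
  unfolding circ_conv_def by (simp add: sum_distrib_right) (rule sum.swap)

lemma circ_conv_sum_right:
  "circ_conv T x (\<lambda>s. \<Sum>b\<in>B. y b s) t = (\<Sum>b\<in>B. circ_conv T x (y b) t)"
  unfolding circ_conv_def by (simp add: sum_distrib_left) (rule sum.swap)

lemma circ_conv_diff_right:
  "circ_conv T x (\<lambda>s. y s - z s) t = circ_conv T x y t - circ_conv T x z t"
  by (simp add: circ_conv_def right_diff_distrib sum_subtractf)

text \<open>After swapping the sums, translating the inner index by \<open>u\<close> reduces the
  claim to t - (s + u) = (t - u) - s in Z/T.\<close>

lemma circ_conv_assoc: "circ_conv T (circ_conv T x y) z = circ_conv T x (circ_conv T y z)"
proof
  fix t
  have idx: "(t + T - (s + u) mod T) mod T = ((t + T - u) mod T + T - s) mod T"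
    if "s < T" "u < T" for s u
  proof -
    have "int ((t + T - (s + u) mod T) mod T) = (int t - int s - int u) mod int T"
      using that by (subst int_cyclic_diff) (auto simp: zmod_int mod_simps algebra_simps)
    also have "\<dots> = int (((t + T - u) mod T + T - s) mod T)"
      using that by (subst int_cyclic_diff, simp, subst int_cyclic_diff)
        (auto simp: mod_simps algebra_simps)
    finally show ?thesis by linarith
  qed
  have "circ_conv T (circ_conv T x y) z t
      = (\<Sum>u<T. \<Sum>s<T. x u * y ((s + T - u) mod T) * z ((t + T - s) mod T))"
    unfolding circ_conv_def sum_distrib_right by (rule sum.swap)
  also have "\<dots> = (\<Sum>u<T. \<Sum>s<T. x u * y s * z ((t + T - (s + u) mod T) mod T))"
    by (intro sum.cong refl sum_cyclic_shift[where f = "\<lambda>s s'. x _ * y s' * z ((t + T - s) mod T)"])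
       simp
  also have "\<dots> = circ_conv T x (circ_conv T y z) t"
    unfolding circ_conv_def sum_distrib_left by (intro sum.cong refl) (simp add: idx mult.assoc)
  finally show "circ_conv T (circ_conv T x y) z t = circ_conv T x (circ_conv T y z) t" .
qed

text \<open>Translating by \<open>s\<close> moves the shift from \<open>y\<close> to
  \<open>z\<close> with the opposite sign; reversing \<open>s\<close> turns this back into a
  convolution. This is the one-tube case of the transpose being the adjoint.\<close>

lemma circ_conv_adjoint:
  "(\<Sum>t<T. circ_conv T x y t * z t)
   = (\<Sum>t<T. y t * circ_conv T (\<lambda>s. x ((T - s) mod T)) z t)"
proof -
  have idx: "(t + T - (T - s) mod T) mod T = (t + s) mod T" if "s < T" for s t
    using that by (cases "s = 0") auto
  have "(\<Sum>t<T. circ_conv T x y t * z t)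
      = (\<Sum>s<T. \<Sum>t<T. x s * y ((t + T - s) mod T) * z t)"
    unfolding circ_conv_def sum_distrib_right by (rule sum.swap)
  also have "\<dots> = (\<Sum>s<T. \<Sum>t<T. x s * y t * z ((t + s) mod T))"
    by (intro sum.cong refl sum_cyclic_shift[where f = "\<lambda>t t'. x _ * y t' * z t"]) simp
  also have "\<dots> = (\<Sum>t<T. \<Sum>s<T. x s * y t * z ((t + s) mod T))"
    by (rule sum.swap)
  \<comment> \<open>Adding \<open>s\<close> is rewritten as subtracting its negative modulo
    \<open>T\<close>, the form to which the reversal of the index applies.\<close>
  also have "\<dots> = (\<Sum>t<T. \<Sum>s<T. x s * y t * z ((t + T - (T - s) mod T) mod T))"
    by (simp add: idx)
  also have "\<dots> = (\<Sum>t<T. \<Sum>s<T. x ((T - s) mod T) * y t * z ((t + T - s) mod T))"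
    by (intro sum.cong refl
        sum_cyclic_reverse[where f = "\<lambda>s s'. x s * y _ * z ((_ + T - s') mod T)"])
  also have "\<dots> = (\<Sum>t<T. y t * circ_conv T (\<lambda>s. x ((T - s) mod T)) z t)"
    unfolding circ_conv_def sum_distrib_left by (simp add: ac_simps)
  finally show ?thesis .
qed

section \<open>Algebra of the t-product\<close>

lemma t_prod_cong:
  assumes "\<And>j s. j < J \<Longrightarrow> s < T \<Longrightarrow> A i j s = A' i j s"
    and "\<And>j s. j < J \<Longrightarrow> s < T \<Longrightarrow> B j k s = B' j k s"
  shows "t_prod J T A B i k t = t_prod J T A' B' i k t"
  unfolding t_prod_def using assms by (intro sum.cong refl circ_conv_cong) auto

lemma t_prod_diff_right:
  "t_prod J T A (\<lambda>j k t. B j k t - B' j k t) i k t = t_prod J T A B i k t - t_prod J T A B' i k t"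
  by (simp add: t_prod_def circ_conv_diff_right sum_subtractf)

lemma t_prod_assoc: "t_prod K T (t_prod J T A B) D = t_prod J T A (t_prod K T B D)"
proof (intro ext)
  fix i l t
  have "t_prod K T (t_prod J T A B) D i l t
      = (\<Sum>k<K. \<Sum>j<J. circ_conv T (circ_conv T (A i j) (B j k)) (D k l) t)"
    unfolding t_prod_def by (simp add: circ_conv_sum_left)
  also have "\<dots> = (\<Sum>j<J. \<Sum>k<K. circ_conv T (A i j) (circ_conv T (B j k) (D k l)) t)"
    by (subst sum.swap) (simp add: circ_conv_assoc)
  also have "\<dots> = t_prod J T A (t_prod K T B D) i l t"
    unfolding t_prod_def by (simp add: circ_conv_sum_right)
  finally show "t_prod K T (t_prod J T A B) D i l t = t_prod J T A (t_prod K T B D) i l t" .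
qed

text \<open>The tube (1, 0, ..., 0), not the constant tube 1, is neutral for circular convolution;
  all Fourier slices are then identity matrices.\<close>

definition t_identity :: hmatrix where
  "t_identity i j t = (if i = j \<and> t = 0 then 1 else 0)"

lemma t_prod_identity_left:
  assumes "i < R" "t < T"
  shows "t_prod R T t_identity B i k t = B i k t"
proof -
  have "circ_conv T (t_identity i j) y t = (if i = j then y t else 0)" for j y
    using assms(2) by (simp add: circ_conv_def t_identity_def if_distrib if_distribR sum.delta cong: if_cong)
  then show ?thesis using assms(1) by (simp add: t_prod_def)
qed

text \<open>Used to move \<open>U\<close> across the Frobenius inner product; it follows entry by
  entry from \<open>circ_conv_adjoint\<close>.\<close>

lemma t_prod_adjoint:
  "(\<Sum>i<I. \<Sum>k<K. \<Sum>t<T. t_prod J T A B i k t * E i k t)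
   = (\<Sum>j<J. \<Sum>k<K. \<Sum>t<T. B j k t * t_prod I T (t_transpose T A) E j k t)"
proof -
  have "(\<Sum>i<I. \<Sum>k<K. \<Sum>t<T. t_prod J T A B i k t * E i k t)
      = (\<Sum>i<I. \<Sum>k<K. \<Sum>j<J. \<Sum>t<T. circ_conv T (A i j) (B j k) t * E i k t)"
    unfolding t_prod_def sum_distrib_right by (intro sum.cong refl sum.swap)
  also have "\<dots> = (\<Sum>i<I. \<Sum>k<K. \<Sum>j<J. \<Sum>t<T. B j k t * circ_conv T (t_transpose T A j i) (E i k) t)"
    by (simp add: circ_conv_adjoint t_transpose_def[abs_def])
  also have "\<dots> = (\<Sum>j<J. \<Sum>k<K. \<Sum>i<I. \<Sum>t<T. B j k t * circ_conv T (t_transpose T A j i) (E i k) t)"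
    by (subst (2) sum.swap, subst sum.swap, intro sum.cong refl sum.swap)
  also have "\<dots> = (\<Sum>j<J. \<Sum>k<K. \<Sum>t<T. B j k t * t_prod I T (t_transpose T A) E j k t)"
    unfolding t_prod_def sum_distrib_left by (intro sum.cong refl sum.swap)
  finally show ?thesis .
qed

section \<open>Orthogonal projection in the Frobenius norm\<close>

lemma frob_hmatrix_sq: "(frob_hmatrix I J T A)\<^sup>2 = (\<Sum>i<I. \<Sum>j<J. \<Sum>t<T. (A i j t)\<^sup>2)"
  by (simp add: frob_hmatrix_def sum_nonneg)

text \<open>The hypotheses make the residual \<open>E\<close> of \<open>U * D\<close> orthogonal to
  the range of \<open>U\<close>. The error for \<open>D'\<close> splits into \<open>E\<close> and
  \<open>U * (D - D')\<close>, and \<open>U\<close> preserves the norm of the second part.\<close>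

lemma t_projection_pythagoras:
  assumes orth: "\<And>a b t. a < R \<Longrightarrow> b < R \<Longrightarrow> t < T \<Longrightarrow>
      t_prod I T (t_transpose T U) U a b t = t_identity a b t"
    and D: "\<And>a j t. a < R \<Longrightarrow> j < J \<Longrightarrow> t < T \<Longrightarrow>
      t_prod I T (t_transpose T U) C a j t = D a j t"
  shows "(frob_hmatrix I J T (\<lambda>i j t. C i j t - t_prod R T U D' i j t))\<^sup>2
    = (frob_hmatrix I J T (\<lambda>i j t. C i j t - t_prod R T U D i j t))\<^sup>2
      + (frob_hmatrix R J T (\<lambda>i j t. D i j t - D' i j t))\<^sup>2"
proof -
  define E F where "E = (\<lambda>i j t. C i j t - t_prod R T U D i j t)"
    and "F = (\<lambda>i j t. D i j t - D' i j t)"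
  have UU: "t_prod I T (t_transpose T U) (t_prod R T U B) a j t = B a j t"
    if "a < R" "t < T" for a j t B
  proof -
    have "t_prod I T (t_transpose T U) (t_prod R T U B) a j t
        = t_prod R T (t_prod I T (t_transpose T U) U) B a j t"
      by (simp add: t_prod_assoc)
    also have "\<dots> = t_prod R T t_identity B a j t"
      by (rule t_prod_cong) (use orth that in auto)
    finally show ?thesis using that by (simp add: t_prod_identity_left)
  qed
  \<comment> \<open>Normal equations: \<open>U^T * C\<close> and \<open>U^T * (U * D)\<close> are
    both \<open>D\<close>.\<close>
  have UE: "t_prod I T (t_transpose T U) E a j t = 0" if "a < R" "j < J" "t < T" for a j t
    unfolding E_def using that by (simp add: t_prod_diff_right D UU)
  have "C i j t - t_prod R T U D' i j t = t_prod R T U F i j t + E i j t" for i j t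
    by (simp add: E_def F_def t_prod_diff_right)
  then have "(frob_hmatrix I J T (\<lambda>i j t. C i j t - t_prod R T U D' i j t))\<^sup>2
    = (\<Sum>i<I. \<Sum>j<J. \<Sum>t<T. t_prod R T U F i j t * t_prod R T U F i j t)
      + 2 * (\<Sum>i<I. \<Sum>j<J. \<Sum>t<T. t_prod R T U F i j t * E i j t)
      + (\<Sum>i<I. \<Sum>j<J. \<Sum>t<T. (E i j t)\<^sup>2)"
    unfolding frob_hmatrix_sq
    by (simp add: power2_sum sum.distrib sum_distrib_left power2_eq_square algebra_simps)
  also have "(\<Sum>i<I. \<Sum>j<J. \<Sum>t<T. t_prod R T U F i j t * t_prod R T U F i j t)
      = (\<Sum>i<R. \<Sum>j<J. \<Sum>t<T. (F i j t)\<^sup>2)"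
    by (subst t_prod_adjoint) (simp add: UU power2_eq_square)
  also have "(\<Sum>i<I. \<Sum>j<J. \<Sum>t<T. t_prod R T U F i j t * E i j t) = 0"
    by (subst t_prod_adjoint) (simp add: UE)
  finally show ?thesis by (simp add: E_def F_def frob_hmatrix_sq)
qed


section \<open>Discrete Fourier transform\<close>

text \<open>The transform of a single tube, so that the Fourier laws can be proved before entries
  are assembled into slices.\<close>

definition dft :: "nat \<Rightarrow> tube \<Rightarrow> nat \<Rightarrow> complex" where
  "dft T x t = (\<Sum>s<T. complex_of_real (x s) * cis (- 2 * pi * real s * real t / real T))"

lemma fourier_slice_dft: "fourier_slice I J T A t = mat I J (\<lambda>(i, j). dft T (A i j) t)"
  by (simp add: fourier_slice_def dft_def)

lemma cis_root_mod:
  assumes "T > 0"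
  shows "cis (- 2 * pi * real (a mod T) * real t / real T) = cis (- 2 * pi * real a * real t / real T)"
proof -
  have "real a = real T * real (a div T) + real (a mod T)"
    by (metis mult_div_mod_eq of_nat_add of_nat_mult)
  then have "- 2 * pi * real a * real t / real T
      = - 2 * pi * real (a mod T) * real t / real T + 2 * pi * (- (real (a div T) * real t))"
    using assms by (simp add: field_simps)
  moreover have "cis (2 * pi * (- (real (a div T) * real t))) = 1"
    by (rule cis_multiple_2pi) auto
  ultimately show ?thesis by (metis cis_mult mult.right_neutral)
qed

text \<open>Convolution theorem: translating the summation index by \<open>u\<close> splits the root
  of unity into a factor in \<open>s\<close> and one in \<open>u\<close>, so the double sum
  factors.\<close>

lemma dft_circ_conv:
  assumes "T > 0"
  shows "dft T (circ_conv T x y) t = dft T x t * dft T y t"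
proof -
  let ?w = "\<lambda>s. cis (- 2 * pi * real s * real t / real T)"
  have w: "?w ((s + u) mod T) = ?w s * ?w u" for s u
    unfolding cis_root_mod[OF assms] cis_mult by (simp add: algebra_simps add_divide_distrib diff_divide_distrib)
  have "dft T (circ_conv T x y) t
      = (\<Sum>u<T. \<Sum>s<T. of_real (x u) * of_real (y ((s + T - u) mod T)) * ?w s)"
    unfolding dft_def circ_conv_def of_real_sum of_real_mult sum_distrib_right by (rule sum.swap)
  also have "\<dots> = (\<Sum>u<T. \<Sum>s<T. of_real (x u) * of_real (y s) * ?w ((s + u) mod T))"
    by (intro sum.cong refl
        sum_cyclic_shift[where f = "\<lambda>s s'. of_real (x _) * of_real (y s') * ?w s"]) simp
  also have "\<dots> = dft T x t * dft T y t"
    unfolding dft_def sum_product w by (simp add: ac_simps)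
  finally show ?thesis .
qed

lemma dft_sum: "dft T (\<lambda>s. \<Sum>b\<in>B. x b s) t = (\<Sum>b\<in>B. dft T (x b) t)"
  unfolding dft_def by (simp add: sum_distrib_right) (rule sum.swap)

text \<open>Negating the index conjugates the root of unity, while the real entries are fixed by
  conjugation.\<close>

lemma dft_reverse: "dft T (\<lambda>s. x ((T - s) mod T)) t = cnj (dft T x t)"
proof (cases "T = 0")
  case False
  let ?w = "\<lambda>s. cis (- 2 * pi * real s * real t / real T)"
  have w: "?w ((T - s) mod T) = cnj (?w s)" if "s < T" for s
  proof -
    \<comment> \<open>The two roots multiply to 1; multiplying by the conjugate of
      \<open>?w s\<close>, which has modulus 1, isolates the first factor.\<close>
    have "?w ((T - s) mod T) * ?w s = ?w ((T - s) + s)"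
      using False by (subst cis_root_mod) (simp_all add: cis_mult algebra_simps add_divide_distrib diff_divide_distrib)
    also have "\<dots> = 1"
      using that cis_root_mod[of T T t] False by simp
    finally have "?w ((T - s) mod T) * (?w s * cnj (?w s)) = cnj (?w s)"
      by (simp only: mult.assoc[symmetric] mult_1)
    then show ?thesis by (simp add: cis_cnj cis_mult)
  qed
  have "dft T (\<lambda>s. x ((T - s) mod T)) t = (\<Sum>s<T. of_real (x s) * ?w ((T - s) mod T))"
    unfolding dft_def by (rule sum_cyclic_reverse[where f = "\<lambda>s s'. of_real (x s') * ?w s"])
  also have "\<dots> = cnj (dft T x t)"
    unfolding dft_def cnj_sum complex_cnj_mult complex_cnj_complex_of_real
    by (intro sum.cong refl, subst w) auto
  finally show ?thesis .
qed (simp add: dft_def)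

text \<open>Orthogonality of characters: for \<open>s \<noteq> s'\<close> this is a full geometric
  sum whose ratio is a \<open>T\<close>-th root of unity other than 1.\<close>

lemma sum_root_powers:
  assumes "s < T" "s' < T"
  shows "(\<Sum>t<T. cis (2 * pi * (real s - real s') * real t / real T))
    = (if s = s' then of_nat T else 0)"
proof (cases "s = s'")
  case False
  have T: "T > 0" using assms by simp
  \<comment> \<open>As a quotient of two \<open>T\<close>-th roots of unity, \<open>q\<close>
    differs from 1 because distinct exponents below \<open>T\<close> give distinct roots.\<close>
  define q where "q = cis (2 * pi * real s / real T) / cis (2 * pi * real s' / real T)"
  have q: "cis (2 * pi * (real s - real s') * real t / real T) = q ^ t" for t
    by (simp add: q_def cis_divide DeMoivre algebra_simps diff_divide_distrib)
  have "inj_on (\<lambda>k. cis (2 * pi * real k / real T)) {..<T}"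
    using bij_betw_roots_unity[OF T] by (simp add: bij_betw_def)
  then have "q \<noteq> 1" using False assms by (auto simp: q_def inj_on_def)
  moreover have "cis (2 * pi * real k / real T) ^ T = 1" for k
    using T by (simp add: DeMoivre)
  then have "q ^ T = 1" by (simp add: q_def power_divide)
  ultimately have "(\<Sum>t<T. q ^ t) = 0" by (simp add: sum_gp_strict)
  then show ?thesis using False by (simp add: q)
qed simp

lemma dft_inversion:
  assumes "s < T"
  shows "(\<Sum>t<T. dft T x t * cis (2 * pi * real s * real t / real T)) = of_nat T * of_real (x s)"
proof -
  have "(\<Sum>t<T. dft T x t * cis (2 * pi * real s * real t / real T))
      = (\<Sum>t<T. \<Sum>s'<T. of_real (x s') * cis (2 * pi * (real s - real s') * real t / real T))"
    unfolding dft_def sum_distrib_right mult.assoc cis_mult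
    by (simp add: algebra_simps diff_divide_distrib)
  also have "\<dots> = (\<Sum>s'<T. of_real (x s')
      * (\<Sum>t<T. cis (2 * pi * (real s - real s') * real t / real T)))"
    unfolding sum_distrib_left by (rule sum.swap)
  also have "\<dots> = (\<Sum>s'<T. of_real (x s') * (if s = s' then of_nat T else 0))"
    using assms by (simp add: sum_root_powers)
  finally show ?thesis using assms by (simp add: if_distrib cong: if_cong)
qed

section \<open>Fourier slices of hyper-matrices\<close>

lemma fourier_slice_inject:
  assumes "\<And>t. t < T \<Longrightarrow> fourier_slice I J T A t = fourier_slice I J T B t"
    and "i < I" "j < J" "s < T"
  shows "A i j s = B i j s"
proof -
  have "dft T (A i j) t = dft T (B i j) t" if "t < T" for t
  proof -
    have "fourier_slice I J T A t $$ (i, j) = fourier_slice I J T B t $$ (i, j)"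
      using assms(1)[OF that] by simp
    then show ?thesis using assms(2,3) by (simp add: fourier_slice_dft)
  qed
  \<comment> \<open>Inversion recovers \<open>T\<close> times each entry, and \<open>T\<close> is
    nonzero because \<open>s < T\<close>.\<close>
  then have "of_nat T * complex_of_real (A i j s) = of_nat T * complex_of_real (B i j s)"
    using assms(4) by (simp flip: dft_inversion)
  then show ?thesis using assms(4) by simp
qed

lemma fourier_slice_t_prod:
  assumes "T > 0"
  shows "fourier_slice I K T (t_prod J T A B) t = fourier_slice I J T A t * fourier_slice J K T B t"
proof -
  have "dft T (t_prod J T A B i k) t = (\<Sum>j<J. dft T (A i j) t * dft T (B j k) t)" for i k
    using assms by (simp add: t_prod_def[abs_def] dft_sum dft_circ_conv)
  then show ?thesis
    by (intro eq_matI) (auto simp: fourier_slice_dft scalar_prod_def lessThan_atLeast0)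
qed

lemma mat_adjoint_dim [simp]:
  "dim_row (mat_adjoint A) = dim_col A" "dim_col (mat_adjoint A) = dim_row A"
  by (simp_all add: mat_adjoint_def)

lemma mat_adjoint_index:
  fixes A :: "complex mat"
  assumes "i < dim_col A" "j < dim_row A"
  shows "mat_adjoint A $$ (i, j) = cnj (A $$ (j, i))"
  using assms by (simp add: mat_adjoint_def mat_of_rows_index)

lemma fourier_slice_t_transpose:
  "fourier_slice J I T (t_transpose T A) t = mat_adjoint (fourier_slice I J T A t)"
proof (rule eq_matI)
  fix j i assume ji: "j < dim_row (mat_adjoint (fourier_slice I J T A t))"
    "i < dim_col (mat_adjoint (fourier_slice I J T A t))"
  then have "j < J" "i < I" by (auto simp: fourier_slice_dft)
  then show "fourier_slice J I T (t_transpose T A) t $$ (j, i)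
      = mat_adjoint (fourier_slice I J T A t) $$ (j, i)"
    using mat_adjoint_index[of j "fourier_slice I J T A t" i]
    by (simp add: fourier_slice_dft t_transpose_def[abs_def] dft_reverse)
qed (auto simp: fourier_slice_dft)

lemma fourier_slice_t_identity:
  assumes "T > 0"
  shows "fourier_slice R R T t_identity t = 1\<^sub>m R"
proof -
  have "dft T (t_identity i j) t = (if i = j then 1 else 0)" for i j
    using assms
    by (simp add: dft_def t_identity_def if_distrib[of complex_of_real] if_distribR
        if_distrib[of "\<lambda>z. z * _"] sum.delta cong: if_cong)
  then show ?thesis by (intro eq_matI) (auto simp: fourier_slice_dft)
qed


section \<open>The T-SVD as an orthogonal projection\<close>

text \<open>Conjugating the left singular vector equation gives the rows of the claim, with
  conjugated singular values; these are unchanged because they are real.\<close>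

lemma truncated_svd_projection:
  assumes "truncated_svd R M U S V"
  shows "mat_adjoint U * M = S * mat_adjoint V"
proof (rule eq_matI)
  from assms have U: "U \<in> carrier_mat (dim_row M) R" and S: "S \<in> carrier_mat R R"
    and V: "V \<in> carrier_mat (dim_col M) R" and diag: "diagonal_mat S"
    and sv: "mset (diag_mat S) = image_mset complex_of_real (mset (take R (singular_values M)))"
    and left: "\<And>k. k < R \<Longrightarrow> mat_adjoint M *\<^sub>v col U k = S $$ (k, k) \<cdot>\<^sub>v col V k"
    by (auto simp: truncated_svd_def)
  fix a j assume "a < dim_row (S * mat_adjoint V)" "j < dim_col (S * mat_adjoint V)"
  then have a: "a < R" and j: "j < dim_col M" using S V by auto
  \<comment> \<open>Realness comes from the multiset condition: every diagonal entry of
    \<open>S\<close> is the image of a member of the real list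
    \<open>singular_values M\<close>.\<close>
  have "S $$ (a, a) \<in># mset (diag_mat S)"
    using a S by (auto simp: diag_mat_def)
  then obtain \<sigma> where \<sigma>: "S $$ (a, a) = complex_of_real \<sigma>"
    unfolding sv by auto
  have "(\<Sum>i<dim_row M. cnj (M $$ (i, j)) * U $$ (i, a)) = (mat_adjoint M *\<^sub>v col U a) $ j"
    using a j U by (simp add: scalar_prod_def mat_adjoint_index lessThan_atLeast0)
  also have "\<dots> = of_real \<sigma> * V $$ (j, a)"
    using a j V by (simp add: left \<sigma>)
  finally have "cnj (\<Sum>i<dim_row M. cnj (M $$ (i, j)) * U $$ (i, a)) = cnj (of_real \<sigma> * V $$ (j, a))"
    by simp
  then have 1: "(\<Sum>i<dim_row M. cnj (U $$ (i, a)) * M $$ (i, j)) = of_real \<sigma> * cnj (V $$ (j, a))"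
    by (simp add: mult.commute)
  have "(\<Sum>b<R. S $$ (a, b) * cnj (V $$ (j, b)))
      = (\<Sum>b<R. if b = a then of_real \<sigma> * cnj (V $$ (j, a)) else 0)"
    using diag a S by (intro sum.cong) (auto simp: diagonal_mat_def \<sigma>)
  with 1 show "(mat_adjoint U * M) $$ (a, j) = (S * mat_adjoint V) $$ (a, j)"
    using a j U S V by (simp add: scalar_prod_def mat_adjoint_index lessThan_atLeast0 sum.delta)
qed (use assms in \<open>auto simp: truncated_svd_def\<close>)

lemma truncated_tsvd_orthonormal:
  assumes "truncated_tsvd I J T R C U S V" "a < R" "b < R" "t < T"
  shows "t_prod I T (t_transpose T U) U a b t = t_identity a b t"
proof (rule fourier_slice_inject[OF _ assms(2,3,4)])
  fix t assume "t < T"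
  then show "fourier_slice R R T (t_prod I T (t_transpose T U) U) t = fourier_slice R R T t_identity t"
    using assms(1) by (simp add: fourier_slice_t_prod fourier_slice_t_transpose
        fourier_slice_t_identity truncated_tsvd_def truncated_svd_def)
qed

lemma truncated_tsvd_projection:
  assumes "truncated_tsvd I J T R C U S V" "a < R" "j < J" "t < T"
  shows "t_prod I T (t_transpose T U) C a j t = t_prod R T S (t_transpose T V) a j t"
proof (rule fourier_slice_inject[OF _ assms(2,3,4)])
  fix t assume "t < T"
  then show "fourier_slice R J T (t_prod I T (t_transpose T U) C) t
      = fourier_slice R J T (t_prod R T S (t_transpose T V)) t"
    using assms(1) by (auto simp: fourier_slice_t_prod fourier_slice_t_transpose
        truncated_tsvd_def intro: truncated_svd_projection)
qed


text \<open>\<open>D\<close> is left arbitrary so that the contraction of all later cores can be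
  inserted for it.\<close>

lemma truncated_tsvd_pythagoras:
  assumes "truncated_tsvd I J T R C U S V"
  shows "(frob_hmatrix I J T (\<lambda>i j t. C i j t - t_prod R T U D i j t))\<^sup>2
    = (frob_hmatrix I J T
        (\<lambda>i j t. C i j t - t_prod R T (t_prod R T U S) (t_transpose T V) i j t))\<^sup>2
      + (frob_hmatrix R J T (\<lambda>i j t. t_prod R T S (t_transpose T V) i j t - D i j t))\<^sup>2"
  unfolding t_prod_assoc
  by (rule t_projection_pythagoras)
     (use truncated_tsvd_orthonormal truncated_tsvd_projection assms in auto)


section \<open>Sums over multi-indices\<close>

lemma sum_multi_indices_Cons:
  "(\<Sum>is\<in>multi_indices (d # ds). f is) = (\<Sum>i<d. \<Sum>is\<in>multi_indices ds. f (i # is))"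
proof -
  have "inj_on (\<lambda>(i, is). i # is) ({..<d} \<times> multi_indices ds)"
    by (auto simp: inj_on_def)
  then show ?thesis
    unfolding multi_indices_Cons sum.cartesian_product
    by (subst sum.reindex) (auto intro: sum.cong)
qed

section \<open>Reshaping by an index ordering\<close>

context
  fixes enc :: "nat list \<Rightarrow> nat list \<Rightarrow> nat"
  assumes enc: "index_ordering enc"
begin

lemma enc_bij: "bij_betw (enc ds) (multi_indices ds) {..<prod_list ds}"
  using enc by (auto simp: index_ordering_def)

lemma enc_decode: "q < prod_list ds \<Longrightarrow> enc ds (decode enc ds q) = q"
  unfolding decode_def by (rule bij_betw_inv_into_right[OF enc_bij]) simp

lemma sum_multi_indices_decode:
  "(\<Sum>is\<in>multi_indices ds. f is) = (\<Sum>q<prod_list ds. f (decode enc ds q))"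
  unfolding decode_def
  by (rule sum.reindex_bij_betw[OF bij_betw_inv_into[OF enc_bij], symmetric])

lemma sum_pairs_decode:
  "(\<Sum>a<d. \<Sum>i<e. f a i) = (\<Sum>p<d * e. f (decode enc [d, e] p ! 0) (decode enc [d, e] p ! 1))"
proof -
  have "(\<Sum>a<d. \<Sum>i<e. f a i) = (\<Sum>ai\<in>multi_indices [d, e]. f (ai ! 0) (ai ! 1))"
    by (simp add: sum_multi_indices_Cons multi_indices_Nil)
  then show ?thesis by (simp add: sum_multi_indices_decode)
qed

text \<open>\<open>regroup\<close> reads a decoded row through its two entries, while
  \<open>split_rows\<close> encodes a pair; this makes the two reshapes cancel.\<close>

lemma enc_decode_pair:
  assumes "p < d * e"
  shows "enc [d, e] [decode enc [d, e] p ! 0, decode enc [d, e] p ! 1] = p"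
proof -
  have "decode enc [d, e] p \<in> multi_indices [d, e]"
    unfolding decode_def using bij_betw_inv_into[OF enc_bij, of "[d, e]"] assms
    by (auto simp: bij_betw_def)
  then obtain a i where "decode enc [d, e] p = [a, i]"
    by (auto simp: multi_indices_Cons multi_indices_Nil)
  then show ?thesis using enc_decode[of p "[d, e]"] assms by simp
qed

end

lemma step_cols_prod_list: "step_cols N I n = prod_list (map I [n+1..<N+1])"
proof -
  have "{n+1..N} = set [n+1..<N+1]" by auto
  then show ?thesis
    unfolding step_cols_def by (simp only: prod.distinct_set_conv_list[OF distinct_upt])
qed


section \<open>The contraction of the trailing cores\<close>

text \<open>The cores in \<open>ns\<close> and the last core, with the rank index \<open>a\<close>
  on the left kept open. Nesting to the right makes each layer a t-product of one core with the
  remaining tail.\<close>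

fun tail_contraction ::
  "nat \<Rightarrow> (nat \<Rightarrow> nat) \<Rightarrow> (nat \<Rightarrow> hcore) \<Rightarrow> hmatrix \<Rightarrow> nat list \<Rightarrow> nat \<Rightarrow> nat list \<Rightarrow> tube" where
  "tail_contraction T r Ymid Ylast [] a js = Ylast a (hd js)"
| "tail_contraction T r Ymid Ylast (n # ns) a js =
     (\<lambda>t. \<Sum>b<r n. circ_conv T (Ymid n a (hd js) b) (tail_contraction T r Ymid Ylast ns b (tl js)) t)"

text \<open>The factors for one choice of rank indices, consumed from the front of the lists instead
  of addressed by position.\<close>

fun tail_tubes ::
  "(nat \<Rightarrow> hcore) \<Rightarrow> hmatrix \<Rightarrow> nat list \<Rightarrow> nat \<Rightarrow> nat list \<Rightarrow> nat list \<Rightarrow> tube list" where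
  "tail_tubes Ymid Ylast [] a as js = [Ylast a (hd js)]"
| "tail_tubes Ymid Ylast (n # ns) a as js =
     Ymid n a (hd js) (hd as) # tail_tubes Ymid Ylast ns (hd as) (tl as) (tl js)"

text \<open>Downward induction from \<open>N\<close>. Core \<open>m\<close> takes its left rank
  index from position \<open>m - 2\<close>; its mode index and right rank index are at position
  \<open>m - 1\<close>, hence the dropped prefixes.\<close>

lemma tail_tubes_upt:
  assumes "2 \<le> m" "m \<le> N" "length as = N - 1" "length js = N"
  shows "map (\<lambda>n. Ymid n (as ! (n - 2)) (js ! (n - 1)) (as ! (n - 1))) [m..<N]
      @ [Ylast (as ! (N - 2)) (js ! (N - 1))]
    = tail_tubes Ymid Ylast [m..<N] (as ! (m - 2)) (drop (m - 1) as) (drop (m - 1) js)"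
  using assms(2,1)
proof (induction rule: inc_induct)
  case base
  then show ?case using assms by (simp add: hd_drop_conv_nth)
next
  case (step m)
  then have "tl (drop (m - 1) as) = drop m as" "tl (drop (m - 1) js) = drop m js"
    by (simp_all add: tl_drop flip: drop_Suc)
  moreover have "Suc m - 2 = m - 1" using step by simp
  ultimately show ?case
    using step assms by (simp add: upt_conv_Cons hd_drop_conv_nth)
qed

text \<open>Associativity turns the left fold into right nesting and linearity moves the rank sums
  inward. The accumulator \<open>x\<close> has to vary in the induction.\<close>

lemma sum_foldl_tail_tubes:
  "(\<Sum>as\<in>multi_indices (map r ns). foldl (circ_conv T) x (tail_tubes Ymid Ylast ns a as js) t)
   = circ_conv T x (tail_contraction T r Ymid Ylast ns a js) t"
proof (induction ns arbitrary: x a js)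
  case Nil
  show ?case by (simp add: multi_indices_Nil)
next
  case (Cons n ns)
  show ?case
    by (simp add: sum_multi_indices_Cons Cons.IH circ_conv_assoc circ_conv_sum_right)
qed

lemma ttt_contraction_tail:
  assumes "N \<ge> 2" "length js = N - 1"
  shows "ttt_contraction N r T Yfirst Ymid Ylast (i # js) t
    = (\<Sum>a<r 1. circ_conv T (Yfirst i a) (tail_contraction T r Ymid Ylast [2..<N] a js) t)"
proof -
  have upt: "[1..<N] = 1 # [2..<N]" using assms(1) by (simp add: upt_conv_Cons numeral_2_eq_2)
  have tubes: "map (\<lambda>n. Ymid n ((a # as) ! (n - 2)) ((i # js) ! (n - 1)) ((a # as) ! (n - 1))) [2..<N]
      @ [Ylast ((a # as) ! (N - 2)) ((i # js) ! (N - 1))] = tail_tubes Ymid Ylast [2..<N] a as js"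
    if "as \<in> multi_indices (map r [2..<N])" for a as
  proof -
    have "length as = N - 2"
      using that by (auto simp: multi_indices_def dest: list_all2_lengthD)
    then show ?thesis
      using assms by (subst tail_tubes_upt) auto
  qed
  have "ttt_contraction N r T Yfirst Ymid Ylast (i # js) t
    = (\<Sum>a<r 1. \<Sum>as\<in>multi_indices (map r [2..<N]).
        foldl (circ_conv T) (Yfirst i a) (tail_tubes Ymid Ylast [2..<N] a as js) t)"
    unfolding ttt_contraction_def upt list.map sum_multi_indices_Cons
    by (intro sum.cong refl, subst tubes) auto
  then show ?thesis by (simp add: sum_foldl_tail_tubes)
qed


section \<open>Error of a run\<close>

text \<open>Downward induction on \<open>n\<close>: one application of Pythagoras splits off the
  local error of step \<open>n + 1\<close> and leaves the same quantity for
  \<open>n + 1\<close>.\<close>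

lemma ttt_svd_tail_error:
  assumes enc: "index_ordering enc"
    and run: "ttt_svd_run enc N I r T X C U S V Yfirst Ymid Ylast"
    and n: "1 \<le> n" "n \<le> N - 1"
  shows "(\<Sum>a<r n. \<Sum>js\<in>multi_indices (map I [n+1..<N+1]). \<Sum>t<T.
        (t_prod (r n) T (S n) (t_transpose T (V n)) a (enc (map I [n+1..<N+1]) js) t
          - tail_contraction T r Ymid Ylast [n+1..<N] a js t)\<^sup>2)
    = (\<Sum>m\<in>{n+1..<N}. (frob_hmatrix (step_rows I r m) (step_cols N I m) T (\<lambda>i j t. C m i j t
        - t_prod (r m) T (t_prod (r m) T (U m) (S m)) (t_transpose T (V m)) i j t))\<^sup>2)"
  using n(2,1)
proof (induction rule: inc_induct)
  \<comment> \<open>After the last decomposition nothing is discarded, so both sides are 0. The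
    column number equals the index of mode \<open>N\<close> because a single index is its own
    position.\<close>
  case base
  then have N: "N - 1 + 1 = N" "[N..<N+1] = [N]" by auto
  have "Ylast = t_prod (r (N - 1)) T (S (N - 1)) (t_transpose T (V (N - 1)))"
    using run by (simp add: ttt_svd_run_def)
  moreover have "enc [I N] [i] = i" if "i < I N" for i
    using enc that by (auto simp: index_ordering_def)
  ultimately show ?case
    unfolding N by (simp add: sum_multi_indices_Cons multi_indices_Nil)
next
  case (step n)
  let ?m = "Suc n"
  let ?J = "map I [?m+1..<N+1]"
  let ?D = "\<lambda>n. t_prod (r n) T (S n) (t_transpose T (V n))"
  \<comment> \<open>The tail as a hyper-matrix: column \<open>q\<close> stands for the multi-index
    it decodes to.\<close>
  let ?W = "\<lambda>b q. tail_contraction T r Ymid Ylast [?m+1..<N] b (decode enc ?J q)"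
  let ?pair = "decode enc [r n, I ?m]"
  from step have m: "?m < N" "1 \<le> n" by auto
  have upt: "[n+1..<N+1] = ?m # [?m+1..<N+1]" "[n+1..<N] = ?m # [?m+1..<N]"
    using m by (simp_all add: upt_conv_Cons)
  have C: "C ?m = regroup enc N I r ?m (?D n)" and Y: "Ymid ?m = split_rows enc (r n) (I ?m) (U ?m)"
    using run m by (auto simp: ttt_svd_run_def)
  have svd: "truncated_tsvd (step_rows I r ?m) (step_cols N I ?m) T (r ?m) (C ?m) (U ?m) (S ?m) (V ?m)"
    using run m unfolding ttt_svd_run_def by (metis Suc_eq_plus1 atLeastLessThan_iff le_add2)
  have rows: "step_rows I r ?m = r n * I ?m" using m by (simp add: step_rows_def)
  have "(\<Sum>a<r n. \<Sum>js\<in>multi_indices (map I [n+1..<N+1]). \<Sum>t<T.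
        (?D n a (enc (map I [n+1..<N+1]) js) t
          - tail_contraction T r Ymid Ylast [n+1..<N] a js t)\<^sup>2)
    = (\<Sum>a<r n. \<Sum>i<I ?m. \<Sum>q<step_cols N I ?m. \<Sum>t<T.
        (?D n a (enc (I ?m # ?J) (i # decode enc ?J q)) t
          - (\<Sum>b<r ?m. circ_conv T (Ymid ?m a i b) (?W b q) t))\<^sup>2)"
    unfolding upt list.map sum_multi_indices_Cons
    by (simp only: sum_multi_indices_decode[OF enc] step_cols_prod_list
        tail_contraction.simps list.sel)
  also have "\<dots> = (\<Sum>p<r n * I ?m. \<Sum>q<step_cols N I ?m. \<Sum>t<T.
        (?D n (?pair p ! 0) (enc (I ?m # ?J) (?pair p ! 1 # decode enc ?J q)) t
          - (\<Sum>b<r ?m. circ_conv T (Ymid ?m (?pair p ! 0) (?pair p ! 1) b) (?W b q) t))\<^sup>2)"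
    by (rule sum_pairs_decode[OF enc])
  \<comment> \<open>Reshaping only permutes entries: at row \<open>p\<close> the core
    \<open>Ymid\<close> is row \<open>p\<close> of \<open>U\<close>, so the inner sum is the
    t-product of \<open>U\<close> with the tail.\<close>
  also have "\<dots> = (\<Sum>p<r n * I ?m. \<Sum>q<step_cols N I ?m. \<Sum>t<T.
        (C ?m p q t - t_prod (r ?m) T (U ?m) ?W p q t)\<^sup>2)"
    using upt(1) by (intro sum.cong refl)
      (simp only: C Y regroup_def Let_def split_rows_def t_prod_def[of "r ?m"] diff_Suc_1
        list.map Suc_eq_plus1[symmetric] lessThan_iff enc_decode_pair[OF enc])
  also have "\<dots> = (frob_hmatrix (step_rows I r ?m) (step_cols N I ?m) T
        (\<lambda>i j t. C ?m i j t - t_prod (r ?m) T (U ?m) ?W i j t))\<^sup>2"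
    by (simp add: frob_hmatrix_sq rows)
  also have "\<dots> = (frob_hmatrix (step_rows I r ?m) (step_cols N I ?m) T (\<lambda>i j t. C ?m i j t
        - t_prod (r ?m) T (t_prod (r ?m) T (U ?m) (S ?m)) (t_transpose T (V ?m)) i j t))\<^sup>2
      + (frob_hmatrix (r ?m) (step_cols N I ?m) T (\<lambda>b q t. ?D ?m b q t - ?W b q t))\<^sup>2"
    by (rule truncated_tsvd_pythagoras[OF svd])
  \<comment> \<open>Summing over multi-indices instead of columns restores the form of the induction
    hypothesis.\<close>
  also have "(frob_hmatrix (r ?m) (step_cols N I ?m) T (\<lambda>b q t. ?D ?m b q t - ?W b q t))\<^sup>2
    = (\<Sum>a<r ?m. \<Sum>js\<in>multi_indices ?J. \<Sum>t<T.
        (?D ?m a (enc ?J js) t - tail_contraction T r Ymid Ylast [?m+1..<N] a js t)\<^sup>2)"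
    unfolding frob_hmatrix_sq sum_multi_indices_decode[OF enc] step_cols_prod_list
    by (intro sum.cong refl) (simp add: enc_decode[OF enc])
  also note step.IH
  finally show ?case
    using m by (simp add: sum.atLeast_Suc_lessThan)
qed

theorem theorem1:
  fixes N T :: nat and I r :: "nat \<Rightarrow> nat"
    and enc :: "nat list \<Rightarrow> nat list \<Rightarrow> nat"
    and X :: htensor
    and C U S V :: "nat \<Rightarrow> hmatrix"
    and Yfirst Ylast :: hmatrix and Ymid :: "nat \<Rightarrow> hcore"
    and \<delta> :: "nat \<Rightarrow> real"
  assumes "N \<ge> 2" and "T \<ge> 1" and "\<And>n. n \<in> {1..N} \<Longrightarrow> I n \<ge> 1"
    and "index_ordering enc"
    and "\<And>n. n \<in> {1..<N} \<Longrightarrow> 1 \<le> r n \<and> r n \<le> min (step_rows I r n) (step_cols N I n)"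
    and "ttt_svd_run enc N I r T X C U S V Yfirst Ymid Ylast"
    and "\<And>n. n \<in> {1..<N} \<Longrightarrow>
      frob_hmatrix (step_rows I r n) (step_cols N I n) T
        (\<lambda>i j t. C n i j t - t_prod (r n) T (t_prod (r n) T (U n) (S n)) (t_transpose T (V n)) i j t)
      \<le> \<delta> n"
  shows "(frob_htensor (map I [1..<N+1]) T
           (\<lambda>is t. X is t - ttt_contraction N r T Yfirst Ymid Ylast is t))\<^sup>2
         \<le> (\<Sum>n\<in>{1..<N}. (\<delta> n)\<^sup>2)"
proof -
  note enc = assms(4) and run = assms(6)
  let ?J = "map I [2..<N+1]"
  let ?err = "\<lambda>n. frob_hmatrix (step_rows I r n) (step_cols N I n) T (\<lambda>i j t. C n i j t
    - t_prod (r n) T (t_prod (r n) T (U n) (S n)) (t_transpose T (V n)) i j t)"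
  let ?D = "t_prod (r 1) T (S 1) (t_transpose T (V 1))"
  let ?W = "\<lambda>a js. tail_contraction T r Ymid Ylast [2..<N] a js"
  have C: "C 1 = unfold_first enc N I X" and Y: "Yfirst = U 1"
    using run by (auto simp: ttt_svd_run_def)
  have svd: "truncated_tsvd (step_rows I r 1) (step_cols N I 1) T (r 1) (C 1) (U 1) (S 1) (V 1)"
    using run assms(1) unfolding ttt_svd_run_def by (metis Suc_1 Suc_le_lessD atLeastLessThan_iff order_refl)
  have upt: "[1..<N+1] = 1 # [2..<N+1]" using assms(1) by (simp add: upt_conv_Cons numeral_2_eq_2)
  have cols: "step_cols N I 1 = prod_list ?J" by (simp add: step_cols_prod_list numeral_2_eq_2)
  have rows: "step_rows I r 1 = I 1" by (simp add: step_rows_def)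
  have "(frob_htensor (map I [1..<N+1]) T
           (\<lambda>is t. X is t - ttt_contraction N r T Yfirst Ymid Ylast is t))\<^sup>2
    = (\<Sum>i<I 1. \<Sum>js\<in>multi_indices ?J. \<Sum>t<T.
        (X (i # js) t - ttt_contraction N r T Yfirst Ymid Ylast (i # js) t)\<^sup>2)"
    unfolding frob_htensor_def upt list.map sum_multi_indices_Cons by (simp add: sum_nonneg)
  \<comment> \<open>The full contraction is \<open>U 1\<close> times the tail, so the first step has
    the same shape as the later ones.\<close>
  also have "\<dots> = (\<Sum>i<I 1. \<Sum>js\<in>multi_indices ?J. \<Sum>t<T.
        (X (i # js) t - (\<Sum>a<r 1. circ_conv T (U 1 i a) (?W a js) t))\<^sup>2)"
    using assms(1) by (intro sum.cong refl, subst ttt_contraction_tail)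
      (auto simp: multi_indices_def Y dest!: list_all2_lengthD)
  also have "\<dots> = (frob_hmatrix (step_rows I r 1) (step_cols N I 1) T
      (\<lambda>i q t. C 1 i q t - t_prod (r 1) T (U 1) (\<lambda>a q. ?W a (decode enc ?J q)) i q t))\<^sup>2"
    by (simp only: sum_multi_indices_decode[OF enc] frob_hmatrix_sq cols rows C unfold_first_def
        t_prod_def[of "r 1"])
  also have "\<dots> = (?err 1)\<^sup>2 + (frob_hmatrix (r 1) (step_cols N I 1) T
      (\<lambda>a q t. ?D a q t - ?W a (decode enc ?J q) t))\<^sup>2"
    by (rule truncated_tsvd_pythagoras[OF svd])
  also have "(frob_hmatrix (r 1) (step_cols N I 1) T
      (\<lambda>a q t. ?D a q t - ?W a (decode enc ?J q) t))\<^sup>2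
    = (\<Sum>a<r 1. \<Sum>js\<in>multi_indices ?J. \<Sum>t<T. (?D a (enc ?J js) t - ?W a js t)\<^sup>2)"
    unfolding frob_hmatrix_sq sum_multi_indices_decode[OF enc] cols
    by (intro sum.cong refl) (simp add: enc_decode[OF enc])
  also have "\<dots> = (\<Sum>n\<in>{2..<N}. (?err n)\<^sup>2)"
    using ttt_svd_tail_error[OF enc run, of 1] assms(1)
    by (simp only: one_add_one)
  also have "(?err 1)\<^sup>2 + \<dots> = (\<Sum>n\<in>{1..<N}. (?err n)\<^sup>2)"
    using assms(1) by (simp add: sum.atLeast_Suc_lessThan numeral_2_eq_2)
  \<comment> \<open>Squaring is monotone here because each local error is nonnegative, which also
    forces \<open>\<delta> n\<close> to be nonnegative.\<close>
  also have "\<dots> \<le> (\<Sum>n\<in>{1..<N}. (\<delta> n)\<^sup>2)"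
    by (intro sum_mono power_mono assms(7)) (auto simp: frob_hmatrix_def sum_nonneg)
  finally show ?thesis .
qed

end
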